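(* Let $\alpha>1$ be a real number and let $m_1,m_\alpha$ be real numbers with $m_1>0$ and $m_\alpha>m_1^\alpha$. For $\eta\in[0,1)$ consider the problem $$\min_{q\ge 0}\left((1-\eta)q+\sup_{F\in\mathcal F_{1,\alpha}}\mathbb E_F[\tilde d-q]_+\right),$$ and call any minimizer $q^*$ an optimal order quantity. Define $$\eta_0=1-\left(\frac{m_1^\alpha}{m_\alpha}\right)^{1/(\alpha-1)}\in(0,1),\qquad q_0=\left(\frac{\alpha-1}{\alpha}\right)\left(\frac{m_\alpha}{m_1}\right)^{1/(\alpha-1)}.$$ Then: (a) If $\eta\in[0,\eta_0)$, the optimal order quantity is $q^*=0$. (b) If $\eta\in(\eta_0,1)$, the optimal order quantity is strictly positive and satisfies $q^*\ge q_0$. (c) If $\eta=\eta_0$, the set of optimal order quantities contains every value in $[0,q_0]$.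
   Context: $\mathcal F_{1,\alpha}$ denotes the set of all Borel probability distributions $F$ on $[0,\infty)$ with $\int_0^\infty w\,dF(w)=m_1$ and $\int_0^\infty w^\alpha\,dF(w)=m_\alpha$. For $F\in\mathcal F_{1,\alpha}$, $\tilde d$ denotes a random variable with distribution $F$, and $\mathbb E_F[\tilde d-q]_+=\int_0^\infty \max(0,w-q)\,dF(w)$. *)

theory Defs
  imports "HOL-Probability.Probability"
begin

text \<open>
  The ambiguity set: Borel probability measures concentrated on \<open>[0, \<infinity>)\<close>. Integrability is required
  explicitly, because a Bochner integral that does not exist has the value \<open>0\<close>.
\<close>

definition moment_ambiguity_set :: "real \<Rightarrow> real \<Rightarrow> real \<Rightarrow> real measure set" where
  "moment_ambiguity_set \<alpha> m1 m\<alpha> =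
     {F. real_distribution F \<and> measure F {0..} = 1 \<and>
         set_integrable F {0..} (\<lambda>w. w) \<and> (LINT w:{0..}|F. w) = m1 \<and>
         set_integrable F {0..} (\<lambda>w. w powr \<alpha>) \<and> (LINT w:{0..}|F. w powr \<alpha>) = m\<alpha>}"

definition expected_shortage :: "real measure \<Rightarrow> real \<Rightarrow> real" where
  "expected_shortage F q = (LINT w:{0..}|F. max 0 (w - q))"

text \<open>
  The supremum is taken in the reals. This is the true supremum for \<open>q \<ge> 0\<close>: see
  \<open>bdd_above_expected_shortage\<close> and \<open>moment_ambiguity_set_nonempty\<close> below.
\<close>

definition robust_cost :: "real \<Rightarrow> real \<Rightarrow> real \<Rightarrow> real \<Rightarrow> real \<Rightarrow> real" where
  "robust_cost \<alpha> m1 m\<alpha> \<eta> q =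
     (1 - \<eta>) * q + (SUP F\<in>moment_ambiguity_set \<alpha> m1 m\<alpha>. expected_shortage F q)"

definition optimal_order_quantities :: "real \<Rightarrow> real \<Rightarrow> real \<Rightarrow> real \<Rightarrow> real set" where
  "optimal_order_quantities \<alpha> m1 m\<alpha> \<eta> =
     {q. is_arg_min (robust_cost \<alpha> m1 m\<alpha> \<eta>) (\<lambda>q. 0 \<le> q) q}"

definition critical_ratio :: "real \<Rightarrow> real \<Rightarrow> real \<Rightarrow> real" where
  "critical_ratio \<alpha> m1 m\<alpha> = 1 - (m1 powr \<alpha> / m\<alpha>) powr (1 / (\<alpha> - 1))"

definition critical_quantity :: "real \<Rightarrow> real \<Rightarrow> real \<Rightarrow> real" where
  "critical_quantity \<alpha> m1 m\<alpha> = ((\<alpha> - 1) / \<alpha>) * (m\<alpha> / m1) powr (1 / (\<alpha> - 1))"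

lemma bdd_above_expected_shortage:
  assumes "0 \<le> q"
  shows "bdd_above ((\<lambda>F. expected_shortage F q) ` moment_ambiguity_set \<alpha> m1 m\<alpha>)"
proof (rule bdd_aboveI2)
  fix F assume F: "F \<in> moment_ambiguity_set \<alpha> m1 m\<alpha>"
  then interpret real_distribution F by (simp add: moment_ambiguity_set_def)
  have int: "set_integrable F {0..} (\<lambda>w. w)"
    using F by (simp add: moment_ambiguity_set_def)
  have "set_integrable F {0..} (\<lambda>w. max 0 (w - q))"
    unfolding set_integrable_def
    by (rule Bochner_Integration.integrable_bound[OF int[unfolded set_integrable_def]])
      (use assms in \<open>auto simp: indicator_def\<close>)
  then have "expected_shortage F q \<le> (LINT w:{0..}|F. w)"
    unfolding expected_shortage_def using int assms by (intro set_integral_mono) auto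
  then show "expected_shortage F q \<le> m1"
    using F by (simp add: moment_ambiguity_set_def)
qed

lemma moment_ambiguity_set_nonempty:
  assumes "1 < \<alpha>" "0 < m1" "m1 powr \<alpha> < m\<alpha>"
  shows "moment_ambiguity_set \<alpha> m1 m\<alpha> \<noteq> {}"
proof -
  define t where "t = (m\<alpha> / m1) powr (1 / (\<alpha> - 1))"
  define p where "p = m1 / t"
  define F where "F = distr (measure_pmf (bernoulli_pmf p)) borel (\<lambda>b. if b then t else 0)"
  have m\<alpha>: "0 < m\<alpha>" using assms by (smt (verit) powr_ge_zero)
  then have t: "0 < t" unfolding t_def using assms by simp
  have t_pow: "t powr (\<alpha> - 1) = m\<alpha> / m1"
    unfolding t_def using assms m\<alpha> by (simp add: powr_powr)
  have "m1 powr (\<alpha> - 1) < m\<alpha> / m1"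
    using assms by (simp add: powr_diff divide_strict_right_mono)
  then have "m1 powr (\<alpha> - 1) < t powr (\<alpha> - 1)" by (simp add: t_pow)
  then have "m1 < t"
    using assms t powr_mono2[of "\<alpha> - 1" t m1] by linarith
  then have p: "0 \<le> p" "p \<le> 1" unfolding p_def using assms t by auto
  have "t powr \<alpha> = t * (m\<alpha> / m1)"
    using t t_pow by (simp add: powr_diff field_simps)
  then have pt: "p * t = m1" "p * t powr \<alpha> = m\<alpha>"
    unfolding p_def using t assms by auto
  have "real_distribution F"
    unfolding F_def by (intro prob_space.real_distribution_distr prob_space_measure_pmf) simp
  moreover have "measure F {0..} = 1"
    unfolding F_def using t by (subst measure_distr) (auto simp: vimage_def if_distrib)
  moreover have set_int: "set_integrable F {0..} g \<and> (LINT w:{0..}|F. g w) = p * g t + (1 - p) * g 0"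
    if [measurable]: "g \<in> borel_measurable borel" for g :: "real \<Rightarrow> real"
    unfolding set_integrable_def set_lebesgue_integral_def F_def
    using p t by (simp add: integrable_distr_eq integral_distr integrable_measure_pmf_finite)
  ultimately have "F \<in> moment_ambiguity_set \<alpha> m1 m\<alpha>"
    using set_int[of "\<lambda>w. w"] set_int[of "\<lambda>w. w powr \<alpha>"] pt
    by (simp add: moment_ambiguity_set_def)
  then show ?thesis by blast
qed

end

theory Submission
  imports Defs
begin

text \<open>
  Put \<open>t = (m\<alpha> / m1) powr (1 / (\<alpha> - 1))\<close>, so that \<open>critical_ratio = 1 - m1 / t\<close> and
  \<open>critical_quantity = (\<alpha> - 1) / \<alpha> * t\<close>. The two-point distribution on \<open>{0, t}\<close> with mass
  \<open>m1 / t\<close> at \<open>t\<close> is feasible and shows that the worst-case shortage at \<open>q\<close> is at least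
  \<open>m1 - m1 / t * q\<close>. For \<open>q \<le> critical_quantity\<close> this is an equality, by weak duality: the function
  \<open>a * w + b * w powr \<alpha>\<close> that meets \<open>max 0 (w - q)\<close> at \<open>0\<close> and touches it at \<open>t\<close> dominates it,
  because \<open>a\<close> and \<open>b\<close> are nonnegative. So the cost starts linearly, with slope
  \<open>critical_ratio - \<eta>\<close>, and lies above that line everywhere. A minimizer exists because the cost is
  continuous and coercive.
\<close>

section \<open>Tangent lines to a power function\<close>

lemma powr_ge_tangent:
  fixes \<alpha> t w :: real
  assumes "1 \<le> \<alpha>" "0 < t" "0 \<le> w"
  shows "t powr \<alpha> + \<alpha> * t powr (\<alpha> - 1) * (w - t) \<le> w powr \<alpha>"
\<comment> \<open>The convexity argument runs on the open half-line. At the endpoint the tangent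
  takes the value \<open>(1 - \<alpha>) * t powr \<alpha>\<close>, which is at most
  \<open>0 powr \<alpha> = 0\<close>.\<close>
proof (cases "w = 0")
  case True
  have "t powr \<alpha> = t powr (\<alpha> - 1) * t"
    using assms by (simp add: powr_diff)
  then have "t powr \<alpha> + \<alpha> * t powr (\<alpha> - 1) * (w - t) = (1 - \<alpha>) * t powr \<alpha>"
    using True by (simp add: algebra_simps)
  also have "\<dots> \<le> 0"
    using assms by (simp add: mult_nonpos_nonneg)
  finally show ?thesis using True by simp
next
  case False
  have "\<alpha> * t powr (\<alpha> - 1) * (w - t) \<le> w powr \<alpha> - t powr \<alpha>"
  proof (rule convex_on_imp_above_tangent[where A = "{0<..}"])
    show "convex_on {0<..} (\<lambda>x. x powr \<alpha>)"
      using assms by (intro powr_convex)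
    show "((\<lambda>x. x powr \<alpha>) has_real_derivative \<alpha> * t powr (\<alpha> - 1)) (at t within {0<..})"
      using assms by (auto intro!: derivative_eq_intros)
  qed (use assms False in \<open>auto simp: interior_open\<close>)
  then show ?thesis by simp
qed

section \<open>Worst-case shortage and shortage under a single distribution\<close>

definition worst_case_shortage :: "real \<Rightarrow> real \<Rightarrow> real \<Rightarrow> real \<Rightarrow> real" where
  "worst_case_shortage \<alpha> m1 m\<alpha> q = (SUP F\<in>moment_ambiguity_set \<alpha> m1 m\<alpha>. expected_shortage F q)"

lemma robust_cost_eq:
  "robust_cost \<alpha> m1 m\<alpha> \<eta> q = (1 - \<eta>) * q + worst_case_shortage \<alpha> m1 m\<alpha> q"
  by (simp add: robust_cost_def worst_case_shortage_def)

lemma expected_shortage_le_worst_case: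
  assumes "F \<in> moment_ambiguity_set \<alpha> m1 m\<alpha>" "0 \<le> q"
  shows "expected_shortage F q \<le> worst_case_shortage \<alpha> m1 m\<alpha> q"
  unfolding worst_case_shortage_def
  by (rule cSUP_upper[OF assms(1) bdd_above_expected_shortage[OF assms(2)]])

lemma set_integrable_shortage:
  assumes "F \<in> moment_ambiguity_set \<alpha> m1 m\<alpha>" "0 \<le> q"
  shows "set_integrable F {0..} (\<lambda>w. max 0 (w - q))"
proof -
  interpret real_distribution F using assms by (simp add: moment_ambiguity_set_def)
  have "set_integrable F {0..} (\<lambda>w. w)"
    using assms by (simp add: moment_ambiguity_set_def)
  from this[unfolded set_integrable_def] show ?thesis
    unfolding set_integrable_def
    by (rule Bochner_Integration.integrable_bound) (use assms in \<open>auto simp: indicator_def\<close>)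
qed

text \<open>The integrand is 1-Lipschitz in the order quantity, and \<open>F\<close> has mass 1 on
  \<open>{0..}\<close>. The constant does not depend on \<open>F\<close>, so the bound survives the
  supremum.\<close>

lemma expected_shortage_lipschitz:
  assumes "F \<in> moment_ambiguity_set \<alpha> m1 m\<alpha>" "0 \<le> q" "0 \<le> r"
  shows "expected_shortage F q \<le> expected_shortage F r + \<bar>q - r\<bar>"
proof -
  interpret real_distribution F using assms by (simp add: moment_ambiguity_set_def)
  have c: "set_integrable F {0..} (\<lambda>w. \<bar>q - r\<bar>)"
    by (simp add: set_integrable_def integrable_real_indicator emeasure_eq_measure)
  note int = set_integrable_shortage[OF assms(1)]
  have "expected_shortage F q \<le> (LINT w:{0..}|F. max 0 (w - r) + \<bar>q - r\<bar>)"
    unfolding expected_shortage_def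
    by (intro set_integral_mono set_integral_add int c assms) auto
  also have "\<dots> = expected_shortage F r + (LINT w:{0..}|F. \<bar>q - r\<bar>)"
    unfolding expected_shortage_def by (intro set_integral_add int c assms)
  also have "(LINT w:{0..}|F. \<bar>q - r\<bar>) = \<bar>q - r\<bar>"
    using assms(1) by (simp add: moment_ambiguity_set_def set_lebesgue_integral_def)
  finally show ?thesis .
qed

section \<open>Moment constants and the two-point distribution\<close>

locale moment_problem =
  fixes \<alpha> m1 m\<alpha> :: real
  assumes \<alpha>: "1 < \<alpha>" and m1: "0 < m1" and m\<alpha>_gt: "m1 powr \<alpha> < m\<alpha>"
begin

text \<open>Mass \<open>p\<close> at \<open>t\<close> and the rest at \<open>0\<close> must satisfy
  \<open>p * t = m1\<close> and \<open>p * t powr \<alpha> = m\<alpha>\<close>; dividing the two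
  equations determines \<open>t\<close>.\<close>

definition t :: real where "t = (m\<alpha> / m1) powr (1 / (\<alpha> - 1))"

lemma m\<alpha>: "0 < m\<alpha>"
  using m\<alpha>_gt by (smt (verit) powr_ge_zero)

lemma t_pos: "0 < t"
  using m\<alpha> m1 by (simp add: t_def)

lemma t_pow: "t powr (\<alpha> - 1) = m\<alpha> / m1"
  unfolding t_def using \<alpha> m1 m\<alpha> by (simp add: powr_powr)

lemma t_pow': "t powr \<alpha> = t * (m\<alpha> / m1)"
  using t_pos t_pow by (simp add: powr_diff field_simps)

text \<open>This makes \<open>m1 / t\<close> a probability and the critical ratio positive. It is
  the strict moment condition divided by \<open>m1\<close>, after taking roots.\<close>

lemma m1_less_t: "m1 < t"
proof -
  have "m1 powr (\<alpha> - 1) < m\<alpha> / m1"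
    using m1 m\<alpha>_gt by (simp add: powr_diff divide_strict_right_mono)
  then have "m1 powr (\<alpha> - 1) < t powr (\<alpha> - 1)" by (simp add: t_pow)
  then show ?thesis
    using \<alpha> m1 t_pos powr_mono2[of "\<alpha> - 1" t m1] by linarith
qed

lemma critical_ratio_eq: "critical_ratio \<alpha> m1 m\<alpha> = 1 - m1 / t"
proof -
  have "m1 powr \<alpha> / m\<alpha> = (m1 / t) powr (\<alpha> - 1)"
    using m1 m\<alpha> t_pos by (simp add: powr_divide t_pow) (simp add: powr_diff)
  then show ?thesis
    using \<alpha> m1 t_pos by (simp add: critical_ratio_def powr_powr)
qed

lemma critical_quantity_eq: "critical_quantity \<alpha> m1 m\<alpha> = (\<alpha> - 1) / \<alpha> * t"
  by (simp add: critical_quantity_def t_def)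

lemma critical_quantity_pos: "0 < critical_quantity \<alpha> m1 m\<alpha>"
  using \<alpha> t_pos by (simp add: critical_quantity_eq)

lemma critical_ratio_bounds: "critical_ratio \<alpha> m1 m\<alpha> \<in> {0<..<1}"
  using m1 m1_less_t t_pos by (simp add: critical_ratio_eq)

lemma two_point_distribution:
  obtains F where "F \<in> moment_ambiguity_set \<alpha> m1 m\<alpha>"
    and "\<And>q. 0 \<le> q \<Longrightarrow> expected_shortage F q = m1 / t * max 0 (t - q)"
proof -
  define p where "p = m1 / t"
  define F where "F = distr (measure_pmf (bernoulli_pmf p)) borel (\<lambda>b. if b then t else 0)"
  have p: "0 \<le> p" "p \<le> 1" unfolding p_def using m1 m1_less_t t_pos by auto
  have pt: "p * t = m1" "p * t powr \<alpha> = m\<alpha>"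
    unfolding p_def t_pow' using m1 t_pos by auto
  have "real_distribution F"
    unfolding F_def by (intro prob_space.real_distribution_distr prob_space_measure_pmf) simp
  moreover have "measure F {0..} = 1"
    unfolding F_def using t_pos by (subst measure_distr) (auto simp: vimage_def if_distrib)
  \<comment> \<open>Stated for arbitrary Borel \<open>g\<close>, so that one computation yields the
    mean, the higher moment and the shortage.\<close>
  moreover have set_int: "set_integrable F {0..} g \<and> (LINT w:{0..}|F. g w) = p * g t + (1 - p) * g 0"
    if [measurable]: "g \<in> borel_measurable borel" for g :: "real \<Rightarrow> real"
    unfolding set_integrable_def set_lebesgue_integral_def F_def
    using p t_pos by (simp add: integrable_distr_eq integral_distr integrable_measure_pmf_finite)
  ultimately have "F \<in> moment_ambiguity_set \<alpha> m1 m\<alpha>"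
    using set_int[of "\<lambda>w. w"] set_int[of "\<lambda>w. w powr \<alpha>"] pt
    by (simp add: moment_ambiguity_set_def)
  moreover have "expected_shortage F q = m1 / t * max 0 (t - q)" if "0 \<le> q" for q
    using set_int[of "\<lambda>w. max 0 (w - q)"] that by (simp add: expected_shortage_def p_def)
  ultimately show ?thesis by (rule that)
qed

section \<open>Bounds, exact value and continuity of the worst-case shortage\<close>

abbreviation S :: "real \<Rightarrow> real" where "S \<equiv> worst_case_shortage \<alpha> m1 m\<alpha>"

lemma worst_case_shortage_leI:
  assumes "\<And>F. F \<in> moment_ambiguity_set \<alpha> m1 m\<alpha> \<Longrightarrow> expected_shortage F q \<le> c"
  shows "S q \<le> c"
  unfolding worst_case_shortage_def
  using moment_ambiguity_set_nonempty[OF \<alpha> m1 m\<alpha>_gt] assms by (rule cSUP_least)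

lemma worst_case_shortage_ge:
  assumes "0 \<le> q"
  shows "m1 / t * max 0 (t - q) \<le> S q"
  by (metis two_point_distribution assms expected_shortage_le_worst_case)

lemma worst_case_shortage_nonneg: "0 \<le> q \<Longrightarrow> 0 \<le> S q"
  using worst_case_shortage_ge[of q] m1 t_pos by (smt (verit) divide_nonneg_pos mult_nonneg_nonneg)

lemma worst_case_shortage_ge_linear:
  assumes "0 \<le> q"
  shows "m1 - m1 / t * q \<le> S q"
proof -
  have "m1 - m1 / t * q = m1 / t * (t - q)"
    using t_pos by (simp add: field_simps)
  also have "\<dots> \<le> m1 / t * max 0 (t - q)"
    using m1 t_pos by (intro mult_left_mono) auto
  finally show ?thesis using worst_case_shortage_ge[OF assms] by simp
qed

text \<open>The coefficients solve \<open>a * t + b * t powr \<alpha> = t - q\<close> and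
  \<open>a + \<alpha> * b * t powr (\<alpha> - 1) = 1\<close>: equal value and slope at
  \<open>t\<close>. The condition \<open>0 \<le> a\<close> is exactly
  \<open>q \<le> critical_quantity\<close>, which is where that threshold comes from.\<close>

lemma shortage_le_dual:
  assumes "0 \<le> q" "q \<le> critical_quantity \<alpha> m1 m\<alpha>" "0 \<le> w"
  shows "max 0 (w - q)
    \<le> (1 - \<alpha> * q / ((\<alpha> - 1) * t)) * w + q / ((\<alpha> - 1) * t powr \<alpha>) * w powr \<alpha>"
    (is "_ \<le> ?a * w + ?b * w powr \<alpha>")
proof -
  have b: "0 \<le> ?b" using assms \<alpha> by simp
  have "\<alpha> * q \<le> (\<alpha> - 1) * t"
    using assms(2) \<alpha> by (simp add: critical_quantity_eq field_simps)
  then have "0 \<le> ?a" using \<alpha> t_pos by simp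
  then have "0 \<le> ?a * w + ?b * w powr \<alpha>"
    using assms(3) b by (intro add_nonneg_nonneg mult_nonneg_nonneg) auto
  moreover have "w - q \<le> ?a * w + ?b * w powr \<alpha>"
  proof -
    have tp: "t powr \<alpha> = t powr (\<alpha> - 1) * t" "0 < t powr (\<alpha> - 1)"
      using t_pos by (simp_all add: powr_diff)
    \<comment> \<open>Replacing \<open>w powr \<alpha>\<close> by its tangent at \<open>t\<close>
      turns the dual function into its own tangent there, the line \<open>w - q\<close>.\<close>
    have "w - q = ?a * w + ?b * (t powr \<alpha> + \<alpha> * t powr (\<alpha> - 1) * (w - t))"
      unfolding tp using \<alpha> t_pos tp(2) by (simp add: divide_simps) (simp add: algebra_simps)
    also have "\<dots> \<le> ?a * w + ?b * w powr \<alpha>"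
      using powr_ge_tangent[of \<alpha> t w] \<alpha> t_pos assms b by (intro add_left_mono mult_left_mono) auto
    finally show ?thesis .
  qed
  ultimately show ?thesis by simp
qed

lemma worst_case_shortage_eq:
  assumes "0 \<le> q" "q \<le> critical_quantity \<alpha> m1 m\<alpha>"
  shows "S q = m1 - m1 / t * q"
proof (rule antisym[OF worst_case_shortage_leI worst_case_shortage_ge_linear[OF assms(1)]])
  fix F assume F: "F \<in> moment_ambiguity_set \<alpha> m1 m\<alpha>"
  define a where "a = 1 - \<alpha> * q / ((\<alpha> - 1) * t)"
  define b where "b = q / ((\<alpha> - 1) * t powr \<alpha>)"
  have i1: "set_integrable F {0..} (\<lambda>w. a * w)" and i2: "set_integrable F {0..} (\<lambda>w. b * w powr \<alpha>)"
    using F by (auto simp: moment_ambiguity_set_def)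
  have "expected_shortage F q \<le> (LINT w:{0..}|F. a * w + b * w powr \<alpha>)"
    unfolding expected_shortage_def
    by (intro set_integral_mono set_integral_add i1 i2 set_integrable_shortage[OF F assms(1)])
      (use shortage_le_dual[OF assms] in \<open>auto simp: a_def b_def\<close>)
  also have "\<dots> = (LINT w:{0..}|F. a * w) + (LINT w:{0..}|F. b * w powr \<alpha>)"
    by (intro set_integral_add i1 i2)
  \<comment> \<open>The bound depends on \<open>F\<close> only through the two prescribed moments,
    hence is uniform over the ambiguity set.\<close>
  also have "\<dots> = a * m1 + b * m\<alpha>"
    using F by (simp add: moment_ambiguity_set_def)
  also have "\<dots> = m1 - m1 / t * q"
    unfolding a_def b_def t_pow' using \<alpha> m1 m\<alpha> t_pos
    by (simp add: divide_simps) (simp add: algebra_simps)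
  finally show "expected_shortage F q \<le> m1 - m1 / t * q" .
qed

lemma worst_case_shortage_lipschitz:
  assumes "0 \<le> q" "0 \<le> r"
  shows "S q \<le> S r + \<bar>q - r\<bar>"
proof (rule worst_case_shortage_leI)
  fix F assume F: "F \<in> moment_ambiguity_set \<alpha> m1 m\<alpha>"
  show "expected_shortage F q \<le> S r + \<bar>q - r\<bar>"
    using expected_shortage_lipschitz[OF F assms] expected_shortage_le_worst_case[OF F assms(2)]
    by simp
qed

lemma continuous_on_worst_case_shortage: "continuous_on {0..} S"
proof (rule lipschitz_on_continuous_on)
  show "1-lipschitz_on {0..} S"
    using worst_case_shortage_lipschitz
    by (intro lipschitz_onI) (auto simp: dist_real_def abs_le_iff, fastforce+)
qed

section \<open>The cost and its minimizers\<close>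

abbreviation cost :: "real \<Rightarrow> real \<Rightarrow> real" where "cost \<equiv> robust_cost \<alpha> m1 m\<alpha>"

lemma cost_ge_linear: "0 \<le> q \<Longrightarrow> m1 + (critical_ratio \<alpha> m1 m\<alpha> - \<eta>) * q \<le> cost \<eta> q"
  using worst_case_shortage_ge_linear[of q]
  by (simp add: robust_cost_eq critical_ratio_eq algebra_simps)

lemma cost_eq_linear:
  assumes "0 \<le> q" "q \<le> critical_quantity \<alpha> m1 m\<alpha>"
  shows "cost \<eta> q = m1 + (critical_ratio \<alpha> m1 m\<alpha> - \<eta>) * q"
  using worst_case_shortage_eq[OF assms]
  by (simp add: robust_cost_eq critical_ratio_eq algebra_simps)

lemma cost_0: "cost \<eta> 0 = m1"
  using cost_eq_linear[of 0] critical_quantity_pos by simp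

lemma optimal_iff:
  "q \<in> optimal_order_quantities \<alpha> m1 m\<alpha> \<eta> \<longleftrightarrow> 0 \<le> q \<and> (\<forall>r\<ge>0. cost \<eta> q \<le> cost \<eta> r)"
  by (auto simp: optimal_order_quantities_def is_arg_min_linorder)

lemma optimal_nonempty:
  assumes "\<eta> < 1"
  shows "optimal_order_quantities \<alpha> m1 m\<alpha> \<eta> \<noteq> {}"
proof -
  \<comment> \<open>Beyond \<open>M\<close> the ordering term \<open>(1 - \<eta>) * q\<close> alone
    exceeds \<open>m1\<close>, the cost of ordering nothing, so minimizing over
    \<open>{0..M}\<close> suffices.\<close>
  define M where "M = m1 / (1 - \<eta>)"
  have M: "0 \<le> M" using assms m1 by (simp add: M_def)
  have "continuous_on {0..M} (cost \<eta>)"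
    unfolding robust_cost_eq
    by (intro continuous_intros continuous_on_subset[OF continuous_on_worst_case_shortage]) auto
  then obtain q where q: "q \<in> {0..M}" "\<And>r. r \<in> {0..M} \<Longrightarrow> cost \<eta> q \<le> cost \<eta> r"
    using continuous_attains_inf[of "{0..M}" "cost \<eta>"] M by auto
  have "cost \<eta> q \<le> cost \<eta> r" if "0 \<le> r" for r
  proof (cases "r \<le> M")
    case True
    then show ?thesis using q that by simp
  next
    case False
    have "cost \<eta> q \<le> cost \<eta> 0" using q M by simp
    also have "\<dots> = (1 - \<eta>) * M" using assms by (simp add: cost_0 M_def)
    also have "\<dots> \<le> (1 - \<eta>) * r" using False assms by (intro mult_left_mono) auto
    also have "\<dots> \<le> cost \<eta> r"
      using worst_case_shortage_nonneg[OF that] by (simp add: robust_cost_eq)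
    finally show ?thesis .
  qed
  then have "q \<in> optimal_order_quantities \<alpha> m1 m\<alpha> \<eta>" using q by (simp add: optimal_iff)
  then show ?thesis by blast
qed

lemma optimal_below_critical_ratio:
  assumes "\<eta> < critical_ratio \<alpha> m1 m\<alpha>"
  shows "optimal_order_quantities \<alpha> m1 m\<alpha> \<eta> = {0}"
proof -
  have "m1 < cost \<eta> q" if "0 < q" for q
    using cost_ge_linear[of q \<eta>] mult_pos_pos[of "critical_ratio \<alpha> m1 m\<alpha> - \<eta>" q] that assms
    by linarith
  then show ?thesis
    by (auto simp: set_eq_iff optimal_iff cost_0) (metis cost_0 leD less_eq_real_def order_refl)+
qed

text \<open>On \<open>{0..critical_quantity}\<close> the cost is a line of negative slope, so any
  smaller quantity is beaten by the right endpoint.\<close>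

lemma optimal_above_critical_ratio:
  assumes "critical_ratio \<alpha> m1 m\<alpha> < \<eta>" "q \<in> optimal_order_quantities \<alpha> m1 m\<alpha> \<eta>"
  shows "critical_quantity \<alpha> m1 m\<alpha> \<le> q"
proof (rule ccontr)
  assume less: "\<not> ?thesis"
  have q: "0 \<le> q" using assms by (simp add: optimal_iff)
  have "cost \<eta> (critical_quantity \<alpha> m1 m\<alpha>) < cost \<eta> q"
    using less q assms(1) critical_quantity_pos
    by (simp add: cost_eq_linear mult_less_cancel_left_neg)
  then show False
    using assms(2) critical_quantity_pos by (force simp: optimal_iff not_less[symmetric])
qed

text \<open>Here the slope vanishes: \<open>m1\<close> bounds the cost from below everywhere and is
  attained on the whole interval.\<close>

lemma optimal_at_critical_ratio:
  assumes "q \<in> {0..critical_quantity \<alpha> m1 m\<alpha>}"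
  shows "q \<in> optimal_order_quantities \<alpha> m1 m\<alpha> (critical_ratio \<alpha> m1 m\<alpha>)"
  using assms cost_ge_linear[of _ "critical_ratio \<alpha> m1 m\<alpha>"]
  by (simp add: optimal_iff cost_eq_linear)

end

theorem proposition3p2:
  fixes \<alpha> m1 m\<alpha> :: real
  assumes "1 < \<alpha>" and "0 < m1" and "m1 powr \<alpha> < m\<alpha>"
  shows "critical_ratio \<alpha> m1 m\<alpha> \<in> {0<..<1} \<and>
    (\<forall>\<eta>\<in>{0..<critical_ratio \<alpha> m1 m\<alpha>}. optimal_order_quantities \<alpha> m1 m\<alpha> \<eta> = {0}) \<and>
    (\<forall>\<eta>\<in>{critical_ratio \<alpha> m1 m\<alpha><..<1}.
       optimal_order_quantities \<alpha> m1 m\<alpha> \<eta> \<noteq> {} \<and>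
       (\<forall>q\<in>optimal_order_quantities \<alpha> m1 m\<alpha> \<eta>. 0 < q \<and> critical_quantity \<alpha> m1 m\<alpha> \<le> q)) \<and>
    (\<forall>\<eta>. \<eta> = critical_ratio \<alpha> m1 m\<alpha> \<longrightarrow>
       {0..critical_quantity \<alpha> m1 m\<alpha>} \<subseteq> optimal_order_quantities \<alpha> m1 m\<alpha> \<eta>)"
proof -
  interpret moment_problem \<alpha> m1 m\<alpha> using assms by unfold_locales
  show ?thesis
    \<comment> \<open>Strict positivity in the second regime follows by chaining
      \<open>0 < critical_quantity\<close> with the lower bound on minimizers.\<close>
    using critical_ratio_bounds optimal_below_critical_ratio optimal_nonempty
      optimal_at_critical_ratio
      optimal_above_critical_ratio less_le_trans[OF critical_quantity_pos optimal_above_critical_ratio]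
    by auto
qed

end
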